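(* Let $\widetilde{\mathfrak{A}}$ be an algorithm, $\delta\in(0,1)$ and $C\in\mathbb{R}$ a constant such that, with probability at least $1-\delta$, for any $T\ge1$, $R_T(\widetilde{\mathfrak{A}})\le\widetilde{O}(C\sqrt{T})$. Then for any $T\ge1$, the regret over $T$ episodes of the algorithm \textsf{Budget-Exploration} (defined in the context) run with $\widetilde{\mathfrak{A}}$ and $C$ is bounded, with probability at least $1-\delta$, by $$\widetilde{O}\Big(C\sqrt{T}+\frac{C^2\Delta_0}{\alpha V^{\pi_0}(\alpha V^{\pi_0}+\Delta_0)}\Big).$$
   Context: Setting. The environment is an unknown finite-horizon time-inhomogeneous MDP with state space $\mathcal{S}$, action space $\mathcal{A}$, horizon $H$, initial state $s_1$, transition kernels $p_h(\cdot\mid s,a)$ and random rewards with mean $r_h(s,a)$ for $h\in[H]$ (this includes bandits as the case $H=1$). A policy $\pi$ is a collection of maps $\pi_h:\mathcal{S}\to\Delta(\mathcal{A})$, $h\in[H]$, where $\Delta(\mathcal{A})$ is the set of probability distributions on $\mathcal{A}$. Its value is $V^\pi=\mathbb{E}[\sum_{h=1}^H r_h\mid s_1,\pi]$, and $V^\star=\max_\pi V^\pi$. At each episode $t=1,2,\dots$ an algorithm selects a policy $\pi_t$ based on past observations and observes a trajectory generated by $\pi_t$. The (pseudo-)regret of an algorithm $\mathfrak{A}$ selecting $\pi_1,\pi_2,\dots$ is $R_T(\mathfrak{A})=\sum_{t=1}^T(V^\star-V^{\pi_t})$. Baseline. $\pi_0$ is a given baseline policy with known value $V^{\pi_0}$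 (with $\alpha V^{\pi_0}>0$), $\alpha\in(0,1)$ is the conservative level, and $\Delta_0=V^\star-V^{\pi_0}$ is the sub-optimality gap of $\pi_0$, here assumed known. Algorithm \textsf{Budget-Exploration}. Inputs: a (non-conservative) algorithm $\widetilde{\mathfrak{A}}$, $V^{\pi_0}$, $\alpha\in(0,1)$, $\Delta_0$, and the constant $C$. Set $B=\frac{C^2}{\alpha V^{\pi_0}+\Delta_0}$ and $T_0=\frac{B}{\alpha V^{\pi_0}}$. For $t=1,\dots,T$: if $t<T_0$, play $\pi_0$; otherwise play according to $\widetilde{\mathfrak{A}}$ (which is run only on the episodes $t\ge T_0$, starting from scratch). $\widetilde{O}(\cdot)$ is big-O notation hiding logarithmic factors. *)

theory Defs
  imports "HOL-Probability.Probability"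
begin

text \<open>
  Steps and rounds are counted from 0: round \<open>i\<close> is episode \<open>t = i + 1\<close>. State and action spaces are arbitrary measurable
  spaces (finite ones are covered by taking \<^term>\<open>count_space\<close>).
\<close>

section \<open>Finite-horizon MDPs, policies and values\<close>

record ('s, 'a) mdp =
  states :: "'s measure"
  actions :: "'a measure"
  horizon :: nat
  init :: 's
  transition :: "nat \<Rightarrow> 's \<times> 'a \<Rightarrow> 's measure"
  reward :: "nat \<Rightarrow> 's \<times> 'a \<Rightarrow> real measure"

type_synonym ('s, 'a) policy = "nat \<Rightarrow> 's \<Rightarrow> 'a measure"

text \<open>A trajectory lists the triples (state, action, observed reward).\<close>

type_synonym ('s, 'a) trajectory = "nat \<Rightarrow> 's \<times> 'a \<times> real"

definition policies :: "('s, 'a) mdp \<Rightarrow> ('s, 'a) policy set" where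
  "policies M = {\<pi>. \<forall>h<horizon M. \<pi> h \<in> states M \<rightarrow>\<^sub>M prob_algebra (actions M)}"

definition mean_reward :: "('s, 'a) mdp \<Rightarrow> nat \<Rightarrow> 's \<Rightarrow> 'a \<Rightarrow> real" where
  "mean_reward M h s a = (\<integral>x. x \<partial>reward M h (s, a))"

definition step_space :: "('s, 'a) mdp \<Rightarrow> ('s \<times> 'a \<times> real) measure" where
  "step_space M = states M \<Otimes>\<^sub>M actions M \<Otimes>\<^sub>M borel"

definition trajectory_space :: "('s, 'a) mdp \<Rightarrow> ('s, 'a) trajectory measure" where
  "trajectory_space M = PiM {0..<horizon M} (\<lambda>_. step_space M)"

definition state_law :: "('s, 'a) mdp \<Rightarrow> nat \<Rightarrow> ('s, 'a) trajectory \<Rightarrow> 's measure" where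
  "state_law M h \<tau> =
     (case h of
        0 \<Rightarrow> return (states M) (init M)
      | Suc g \<Rightarrow> transition M g (fst (\<tau> g), fst (snd (\<tau> g))))"

primrec prefix_law ::
    "('s, 'a) mdp \<Rightarrow> ('s, 'a) policy \<Rightarrow> nat \<Rightarrow> ('s, 'a) trajectory measure" where
  "prefix_law M \<pi> 0 = return (PiM {0..<0} (\<lambda>_. step_space M)) (\<lambda>_. undefined)"
| "prefix_law M \<pi> (Suc h) =
     prefix_law M \<pi> h \<bind> (\<lambda>\<tau>.
     state_law M h \<tau> \<bind> (\<lambda>s.
     \<pi> h s \<bind> (\<lambda>a.
     reward M h (s, a) \<bind> (\<lambda>x.
     return (PiM {0..<Suc h} (\<lambda>_. step_space M)) (\<tau>(h := (s, a, x)))))))"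

definition trajectory_law ::
    "('s, 'a) mdp \<Rightarrow> ('s, 'a) policy \<Rightarrow> ('s, 'a) trajectory measure" where
  "trajectory_law M \<pi> = prefix_law M \<pi> (horizon M)"

definition total_mean_reward :: "('s, 'a) mdp \<Rightarrow> ('s, 'a) trajectory \<Rightarrow> real" where
  "total_mean_reward M \<tau> = (\<Sum>h<horizon M. mean_reward M h (fst (\<tau> h)) (fst (snd (\<tau> h))))"

definition policy_value :: "('s, 'a) mdp \<Rightarrow> ('s, 'a) policy \<Rightarrow> real" where
  "policy_value M \<pi> = (\<integral>\<tau>. total_mean_reward M \<tau> \<partial>trajectory_law M \<pi>)"

text \<open>The supremum is the maximum whenever the latter exists.\<close>

definition optimal_value :: "('s, 'a) mdp \<Rightarrow> real" where
  "optimal_value M = (SUP \<pi>\<in>policies M. policy_value M \<pi>)"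

text \<open>
  The last three assumptions say that the mean rewards, the values and the optimal
  value are well defined (Bochner integrals and real suprema default to junk values
  otherwise). They hold for instance for all uniformly bounded rewards.
\<close>

locale finite_horizon_mdp =
  fixes M :: "('s, 'a) mdp"
  assumes horizon_pos: "1 \<le> horizon M"
    and init_state: "init M \<in> space (states M)"
    and transition_kernel:
      "\<And>h. h < horizon M \<Longrightarrow>
        transition M h \<in> states M \<Otimes>\<^sub>M actions M \<rightarrow>\<^sub>M prob_algebra (states M)"
    and reward_kernel:
      "\<And>h. h < horizon M \<Longrightarrow>
        reward M h \<in> states M \<Otimes>\<^sub>M actions M \<rightarrow>\<^sub>M prob_algebra borel"
    and reward_integrable:
      "\<And>h s a. h < horizon M \<Longrightarrow> s \<in> space (states M) \<Longrightarrow> a \<in> space (actions M) \<Longrightarrow>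
        integrable (reward M h (s, a)) (\<lambda>x. x)"
    and total_integrable:
      "\<And>\<pi>. \<pi> \<in> policies M \<Longrightarrow> integrable (trajectory_law M \<pi>) (total_mean_reward M)"
    and values_bounded: "bdd_above (policy_value M ` policies M)"


section \<open>Learning algorithms, their interaction with an MDP, and regret\<close>

text \<open>
  Algorithms may be randomized: in round \<open>i\<close> a fresh random seed is drawn, and the policy is a
  function of the history (seeds and trajectories of the rounds \<open>0, \<dots>, i - 1\<close>) and of that
  seed. Deterministic algorithms ignore the seeds.
\<close>

record ('s, 'a, 'u) algorithm =
  seed :: "'u measure"
  select :: "nat \<Rightarrow> (nat \<Rightarrow> 'u \<times> ('s, 'a) trajectory) \<Rightarrow> 'u \<Rightarrow> ('s, 'a) policy"

definition round_space ::
    "('s, 'a) mdp \<Rightarrow> ('s, 'a, 'u) algorithm \<Rightarrow> ('u \<times> ('s, 'a) trajectory) measure" where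
  "round_space M A = seed A \<Otimes>\<^sub>M trajectory_space M"

locale learning_algorithm =
  fixes M :: "('s, 'a) mdp" and A :: "('s, 'a, 'u) algorithm"
  assumes seed_prob: "prob_space (seed A)"
    and select_kernel:
      "\<And>i h. h < horizon M \<Longrightarrow>
        (\<lambda>(\<omega>, u, s). select A i \<omega> u h s)
          \<in> PiM {0..<i} (\<lambda>_. round_space M A) \<Otimes>\<^sub>M seed A \<Otimes>\<^sub>M states M
             \<rightarrow>\<^sub>M prob_algebra (actions M)"

definition round_law ::
    "('s, 'a) mdp \<Rightarrow> ('s, 'a, 'u) algorithm \<Rightarrow> nat \<Rightarrow> (nat \<Rightarrow> 'u \<times> ('s, 'a) trajectory)
      \<Rightarrow> ('u \<times> ('s, 'a) trajectory) measure" where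
  "round_law M A i \<omega> =
     seed A \<bind> (\<lambda>u.
     trajectory_law M (select A i \<omega> u) \<bind> (\<lambda>\<tau>.
     return (round_space M A) (u, \<tau>)))"

text \<open>
  The joint law of all rounds: the Ionescu-Tulcea measure on infinite sequences
  of rounds determined by the conditional laws \<^const>\<open>round_law\<close>.
\<close>

definition run_law ::
    "('s, 'a) mdp \<Rightarrow> ('s, 'a, 'u) algorithm \<Rightarrow> (nat \<Rightarrow> 'u \<times> ('s, 'a) trajectory) measure" where
  "run_law M A =
     projective_family.lim UNIV
       (Ionescu_Tulcea.CI (round_law M A) (\<lambda>_. round_space M A)) (\<lambda>_. round_space M A)"

definition played_policy ::
    "('s, 'a, 'u) algorithm \<Rightarrow> nat \<Rightarrow> (nat \<Rightarrow> 'u \<times> ('s, 'a) trajectory) \<Rightarrow> ('s, 'a) policy" where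
  "played_policy A i \<omega> = select A i (restrict \<omega> {0..<i}) (fst (\<omega> i))"

definition regret ::
    "('s, 'a) mdp \<Rightarrow> ('s, 'a, 'u) algorithm \<Rightarrow> nat \<Rightarrow> (nat \<Rightarrow> 'u \<times> ('s, 'a) trajectory) \<Rightarrow> real"
  where
  "regret M A T \<omega> = (\<Sum>i<T. optimal_value M - policy_value M (played_policy A i \<omega>))"


section \<open>Budget-Exploration\<close>

definition budget_threshold :: "real \<Rightarrow> real \<Rightarrow> real \<Rightarrow> real \<Rightarrow> real" where
  "budget_threshold V0 \<alpha> \<Delta>0 C =
     (let B = C\<^sup>2 / (\<alpha> * V0 + \<Delta>0) in B / (\<alpha> * V0))"

text \<open>
  The base algorithm only sees the rounds after the first \<open>n0\<close> ones, renumbered from 0,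
  where \<open>n0\<close> is the number of episodes \<open>t = 1, 2, \<dots>\<close> with \<open>t < T0\<close>.
\<close>

definition budget_exploration ::
    "('s, 'a, 'u) algorithm \<Rightarrow> ('s, 'a) policy \<Rightarrow> real \<Rightarrow> real \<Rightarrow> real \<Rightarrow> real
      \<Rightarrow> ('s, 'a, 'u) algorithm" where
  "budget_exploration A \<pi>0 V0 \<alpha> \<Delta>0 C =
     (let T0 = budget_threshold V0 \<alpha> \<Delta>0 C;
          n0 = card {t::nat. 1 \<le> t \<and> real t < T0}
      in \<lparr>seed = seed A,
          select = (\<lambda>i \<omega> u.
            if real (i + 1) < T0 then \<pi>0
            else select A (i - n0) (\<lambda>j\<in>{0..<i - n0}. \<omega> (n0 + j)) u)\<rparr>)"


section \<open>Hidden logarithmic factors\<close>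

text \<open>
  A bound \<open>X \<le> \<O>~(g)\<close> is read as \<open>X \<le> l (Y * T) * g\<close> with \<open>l\<close> one of the functions below.
  The number \<open>Y \<ge> 1\<close> stands for the problem parameters other than \<open>T\<close> that may occur in the
  hidden logarithms (such as the numbers of states and actions, the horizon, and \<open>1 / \<delta>\<close>).
\<close>

definition polylog_factors :: "(real \<Rightarrow> real) set" where
  "polylog_factors = {l. \<exists>c>0. \<exists>k::nat. l = (\<lambda>x. c * (1 + ln x) ^ k)}"

end

theory Submission
  imports Defs
begin

text \<open>
  Let \<open>n\<close> be the number of exploration rounds. Budget-Exploration is the base algorithm delayed by
  \<open>n\<close> rounds, and its conditional round laws depend on the history only through the rounds after
  the first \<open>n\<close>. Hence the left shift by \<open>n\<close> maps its run law to that of the base algorithm, and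
  the high-probability event of the latter can be pulled back. On this event the regret is
  \<open>min T n * \<Delta>0\<close> plus the regret of the base algorithm over \<open>T - n\<close> rounds, and \<open>n\<close> is at most
  the threshold \<open>C\<^sup>2 / (\<alpha> * V0 * (\<alpha> * V0 + \<Delta>0))\<close>. A negative \<open>C\<close> cannot occur, because regrets are
  nonnegative and the event is nonempty.
\<close>

section \<open>Ionescu-Tulcea measures and the left shift\<close>

lemma (in Ionescu_Tulcea) prob_space_lim: "prob_space PF.lim"
\<comment> \<open>Pushing forward preserves total mass, so one marginal suffices; the one on the
  empty index set is the simplest.\<close>
proof (rule prob_space_distrD)
  show "(\<lambda>\<omega>. restrict \<omega> {}) \<in> PF.lim \<rightarrow>\<^sub>M PiM {} M"
    by (auto simp: measurable_cong_sets[OF PF.sets_lim refl])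
  show "prob_space (distr PF.lim (PiM {} M) (\<lambda>\<omega>. restrict \<omega> {}))"
    using PF.prob_space_P[of "{}"] by (simp add: distr_lim)
qed

text \<open>Finite-dimensional marginals are compared. The first \<open>n\<close> coordinates of the
  primed process are integrated out, whatever kernels produced them; from coordinate
  \<open>n\<close> on its kernels read only the shifted history, so the shift commutes with every
  one-step extension. Cylinders then determine the limit.\<close>

lemma Ionescu_Tulcea_lim_shift:
  fixes P P' :: "nat \<Rightarrow> (nat \<Rightarrow> 'a) \<Rightarrow> 'a measure" and M M' :: "nat \<Rightarrow> 'a measure"
  assumes IT: "Ionescu_Tulcea P M" and IT': "Ionescu_Tulcea P' M'"
    and M': "\<And>i. M' (n + i) = M i"
    and P': "\<And>i \<omega>. \<omega> \<in> space (PiM {0..<n + i} M') \<Longrightarrow> P' (n + i) \<omega> = P i (\<lambda>j\<in>{0..<i}. \<omega> (n + j))"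
  shows "distr (projective_family.lim UNIV (Ionescu_Tulcea.CI P' M') M') (PiM UNIV M) (\<lambda>\<omega> j. \<omega> (n + j))
    = projective_family.lim UNIV (Ionescu_Tulcea.CI P M) M"
proof -
  interpret P: Ionescu_Tulcea P M by fact
  interpret P': Ionescu_Tulcea P' M' by fact
  \<comment> \<open>The shift on finite prefixes: a history of length \<open>n + m\<close> becomes
    one of length \<open>m\<close>.\<close>
  define sh where "sh m \<omega> = (\<lambda>j\<in>{0..<m}. \<omega> (n + j))" for m :: nat and \<omega> :: "nat \<Rightarrow> 'a"
  have sh[measurable]: "sh m \<in> PiM {0..<n + m} M' \<rightarrow>\<^sub>M PiM {0..<m} M" for m
    unfolding sh_def
  proof (rule measurable_restrict)
    fix j assume "j \<in> {0..<m}"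
    then show "(\<lambda>\<omega>. \<omega> (n + j)) \<in> PiM {0..<n + m} M' \<rightarrow>\<^sub>M M j"
      using measurable_component_singleton[of "n + j" "{0..<n + m}" M'] by (simp add: M')
  qed
  have shift: "(\<lambda>\<omega> j. \<omega> (n + j)) \<in> PiM UNIV M' \<rightarrow>\<^sub>M PiM UNIV M"
  proof (rule measurable_PiM_single')
    fix j show "(\<lambda>\<omega>. \<omega> (n + j)) \<in> PiM UNIV M' \<rightarrow>\<^sub>M M j"
      using measurable_component_singleton[of "n + j" UNIV M'] by (simp add: M')
  qed (auto simp: space_PiM PiE_iff M'[symmetric])
  \<comment> \<open>\<open>\<lambda>_. undefined\<close> is the only history of length 0, so
    \<open>C 0 m\<close> started there is the law of the first \<open>m\<close> coordinates.\<close>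
  have C: "distr (P'.C 0 (n + m) (\<lambda>_. undefined)) (PiM {0..<m} M) (sh m) = P.C 0 m (\<lambda>_. undefined)" for m
  proof (induction m)
    case 0
    interpret C: prob_space "P'.C 0 n (\<lambda>_. undefined)"
      by (rule P'.prob_space_C) simp
    \<comment> \<open>Since \<open>sh 0\<close> is constant, any probability measure is pushed to
      the point mass that is \<open>P.C 0 0\<close>.\<close>
    have "sh 0 = (\<lambda>_. \<lambda>_. undefined)" by (auto simp: sh_def fun_eq_iff)
    then show ?case by (simp add: C.distr_const)
  next
    case (Suc m)
    let ?C' = "P'.C 0 (n + m) (\<lambda>_. undefined)"
    have sets_C': "sets ?C' = sets (PiM {0..<n + m} M')"
      using P'.sets_C[of "\<lambda>_. undefined" 0 "n + m"] by simp
    note space_C' = sets_eq_imp_space_eq[OF sets_C']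
    interpret C': prob_space ?C'
      by (rule P'.prob_space_C) simp
    \<comment> \<open>Appending coordinate \<open>n + m\<close> and then shifting is the same as
      shifting and then appending coordinate \<open>m\<close>; by \<open>P'\<close> the appended
      value has the same law in both cases.\<close>
    have step: "distr (P'.eP (n + m) \<omega>) (PiM {0..<Suc m} M) (sh (Suc m)) = P.eP m (sh m \<omega>)"
      if \<omega>: "\<omega> \<in> space (PiM {0..<n + m} M')" for \<omega>
    proof -
      have upd: "fun_upd \<omega> (n + m) \<in> P' (n + m) \<omega> \<rightarrow>\<^sub>M PiM {0..<Suc (n + m)} M'"
        unfolding measurable_cong_sets[OF P'.sets_P[OF \<omega>] refl]
        by (rule measurable_fun_upd[where J="{0..<n + m}"]) (use \<omega> in auto)
      have "distr (P'.eP (n + m) \<omega>) (PiM {0..<Suc m} M) (sh (Suc m))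
          = distr (P' (n + m) \<omega>) (PiM {0..<Suc m} M) (sh (Suc m) \<circ> fun_upd \<omega> (n + m))"
        unfolding P'.eP_def using sh[of "Suc m"] upd by (subst distr_distr) auto
      moreover have "sh (Suc m) \<circ> fun_upd \<omega> (n + m) = fun_upd (sh m \<omega>) m"
        by (auto simp: fun_eq_iff sh_def)
      ultimately show ?thesis
        by (simp only: P.eP_def P'[OF \<omega>, folded sh_def])
    qed
    \<comment> \<open>Unfold the last extension, move the pushforward inside the bind, apply
      \<open>step\<close>, and move the shift out again to reach the induction hypothesis.\<close>
    have "distr (P'.C 0 (n + Suc m) (\<lambda>_. undefined)) (PiM {0..<Suc m} M) (sh (Suc m))
        = ?C' \<bind> (\<lambda>\<omega>. distr (P'.eP (n + m) \<omega>) (PiM {0..<Suc m} M) (sh (Suc m)))"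
      using P'.measurable_eP[of "n + m"] sh[of "Suc m"] C'.not_empty
      by (simp add: distr_bind[where K="PiM {0..<Suc (n + m)} M'"] measurable_cong_sets[OF sets_C' refl])
    also have "\<dots> = ?C' \<bind> (\<lambda>\<omega>. P.eP m (sh m \<omega>))"
      by (intro bind_cong refl step) (simp add: space_C')
    also have "\<dots> = distr ?C' (PiM {0..<m} M) (sh m) \<bind> P.eP m"
      using sh[of m] C'.not_empty
      by (subst bind_distr[OF _ P.measurable_eP]) (auto simp: measurable_cong_sets[OF sets_C' refl])
    also have "\<dots> = P.C 0 (Suc m) (\<lambda>_. undefined)"
      using Suc.IH by simp
    finally show ?case .
  qed
  have shift': "(\<lambda>\<omega> j. \<omega> (n + j)) \<in> P'.PF.lim \<rightarrow>\<^sub>M PiM UNIV M"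
    using shift by (simp add: measurable_cong_sets[OF P'.PF.sets_lim refl])
  have "P.PF.lim = distr P'.PF.lim (PiM UNIV M) (\<lambda>\<omega> j. \<omega> (n + j))"
  proof (rule measure_eqI_PiM_infinite[where I=UNIV and M=M])
    show "finite_measure P.PF.lim"
      using P.prob_space_lim by (rule prob_space.finite_measure)
  next
    fix A J assume J: "finite J" and A: "\<And>i. i \<in> J \<Longrightarrow> A i \<in> sets (M i)"
    \<comment> \<open>\<open>m\<close> bounds the finite index set \<open>J\<close>. The cylinder
      thus becomes an event \<open>X\<close> on the first \<open>m\<close> coordinates, and
      \<open>Y\<close> is its preimage among the first \<open>n + m\<close> coordinates of the
      primed process.\<close>
    define m where "m = P.up_to J"
    define X where "X = P.PF.emb {0..<m} J (Pi\<^sub>E J A)"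
    define Y where "Y = sh m -` X \<inter> space (PiM {0..<n + m} M')"
    have Jm: "J \<subseteq> {0..<m}" unfolding m_def by (rule P.up_to[OF J])
    have XJ: "Pi\<^sub>E J A \<in> sets (PiM J M)" by (rule sets_PiM_I_finite[OF J A])
    have X: "X \<in> sets (PiM {0..<m} M)"
      unfolding X_def by (rule measurable_prod_emb[OF Jm XJ])
    have Y: "Y \<in> sets (PiM {0..<n + m} M')"
      unfolding Y_def by (rule measurable_sets[OF sh X])
    have sets_C': "sets (P'.C 0 (n + m) (\<lambda>_. undefined)) = sets (PiM {0..<n + m} M')"
      using P'.sets_C[of "\<lambda>_. undefined" 0 "n + m"] by simp
    have "emeasure P.PF.lim (P.PF.emb UNIV J (Pi\<^sub>E J A)) = P.C 0 m (\<lambda>_. undefined) X"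
      unfolding X_def using J XJ Jm by (subst P.lim) (auto simp: P.emeasure_CI)
    also have "\<dots> = P'.C 0 (n + m) (\<lambda>_. undefined) Y"
      unfolding C[symmetric] Y_def sets_eq_imp_space_eq[OF sets_C', symmetric]
      by (rule emeasure_distr) (use X in \<open>auto simp: measurable_cong_sets[OF sets_C' refl]\<close>)
    also have "\<dots> = P'.CI {0..<n + m} Y"
    proof -
      have "P'.PF.emb {0..<n + m} {0..<n + m} Y = Y"
        using sets.sets_into_space[OF Y] by (auto simp: prod_emb_def space_PiM)
      then show ?thesis using Y by (simp add: P'.emeasure_CI[of _ "n + m"])
    qed
    also have "\<dots> = emeasure P'.PF.lim (P'.PF.emb UNIV {0..<n + m} Y)"
      using Y by (simp add: P'.lim)
    \<comment> \<open>Cutting to \<open>n + m\<close> coordinates before shifting does not affect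
      the coordinates in \<open>J\<close>, so both sides describe the same cylinder.\<close>
    also have "P'.PF.emb UNIV {0..<n + m} Y
        = (\<lambda>\<omega> j. \<omega> (n + j)) -` P.PF.emb UNIV J (Pi\<^sub>E J A) \<inter> space P'.PF.lim"
    proof -
      have "restrict (sh m (restrict \<omega> {0..<n + m})) J = restrict (\<lambda>j. \<omega> (n + j)) J" for \<omega>
        using Jm by (auto simp: sh_def restrict_def fun_eq_iff)
      moreover have "(\<lambda>j. \<omega> (n + j)) \<in> space (PiM UNIV M)"
        and "restrict \<omega> {0..<n + m} \<in> space (PiM {0..<n + m} M')"
        and "sh m (restrict \<omega> {0..<n + m}) \<in> space (PiM {0..<m} M)" if "\<omega> \<in> space (PiM UNIV M')" for \<omega>
      proof -
        show "(\<lambda>j. \<omega> (n + j)) \<in> space (PiM UNIV M)"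
          using measurable_space[OF shift that] .
        show *: "restrict \<omega> {0..<n + m} \<in> space (PiM {0..<n + m} M')"
          using that by (auto simp: space_PiM)
        show "sh m (restrict \<omega> {0..<n + m}) \<in> space (PiM {0..<m} M)"
          using measurable_space[OF sh *] .
      qed
      ultimately show ?thesis
        by (auto simp: prod_emb_def Y_def X_def space_PiM simp del: PiE_iff)
    qed
    also have "emeasure P'.PF.lim \<dots>
        = emeasure (distr P'.PF.lim (PiM UNIV M) (\<lambda>\<omega> j. \<omega> (n + j))) (P.PF.emb UNIV J (Pi\<^sub>E J A))"
      using XJ J by (intro emeasure_distr[symmetric] shift') auto
    finally show "emeasure P.PF.lim (P.PF.emb UNIV J (Pi\<^sub>E J A))
        = emeasure (distr P'.PF.lim (PiM UNIV M) (\<lambda>\<omega> j. \<omega> (n + j))) (P.PF.emb UNIV J (Pi\<^sub>E J A))" .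
  qed simp_all
  then show ?thesis by simp
qed

section \<open>Measurability of trajectory laws and policy values\<close>

context finite_horizon_mdp
begin

lemma measurable_state_law:
  assumes "h \<le> horizon M"
  shows "state_law M h \<in> PiM {0..<h} (\<lambda>_. step_space M) \<rightarrow>\<^sub>M prob_algebra (states M)"
proof (cases h)
  case 0
  have "return (states M) (init M) \<in> space (prob_algebra (states M))"
    using init_state by (simp add: space_prob_algebra prob_space_return)
  then show ?thesis by (simp add: 0 state_law_def[abs_def])
next
  case (Suc g)
  note transition_kernel[of g, measurable]
  have [measurable]: "(\<lambda>\<tau>. \<tau> g) \<in> PiM {0..<Suc g} (\<lambda>_. step_space M) \<rightarrow>\<^sub>M states M \<Otimes>\<^sub>M actions M \<Otimes>\<^sub>M borel"
    using measurable_component_singleton[of g "{0..<Suc g}" "\<lambda>_. step_space M"] by (simp add: step_space_def)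
  \<comment> \<open>State \<open>Suc g\<close> is drawn by the kernel of step \<open>g\<close>, so
    even \<open>h = horizon M\<close> stays within the range of the kernel assumption.\<close>
  have "g < horizon M" using assms Suc by simp
  then have "(\<lambda>\<tau>. transition M g (fst (\<tau> g), fst (snd (\<tau> g))))
      \<in> PiM {0..<Suc g} (\<lambda>_. step_space M) \<rightarrow>\<^sub>M prob_algebra (states M)"
    by measurable
  then show ?thesis by (simp add: Suc state_law_def[abs_def])
qed

text \<open>The set of policies carries no sigma-algebra. Dependence on the policy is therefore
  expressed through a parameter \<open>x\<close>, later a history with a seed, and joint
  measurability in \<open>x\<close> and the state passes through the nested binds by induction on
  \<open>h\<close>.\<close>

lemma measurable_prefix_law:
  assumes K: "\<And>h. h < horizon M \<Longrightarrow> (\<lambda>(x, s). K x h s) \<in> N \<Otimes>\<^sub>M states M \<rightarrow>\<^sub>M prob_algebra (actions M)"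
    and "h \<le> horizon M"
  shows "(\<lambda>x. prefix_law M (K x) h) \<in> N \<rightarrow>\<^sub>M prob_algebra (PiM {0..<h} (\<lambda>_. step_space M))"
  using assms(2)
proof (induction h)
  case 0
  have "return (PiM {0..<0} (\<lambda>_. step_space M)) (\<lambda>_. undefined)
      \<in> space (prob_algebra (PiM {0..<0::nat} (\<lambda>_. step_space M)))"
    by (auto simp: space_prob_algebra space_PiM intro!: prob_space_return)
  then show ?case by simp
next
  case (Suc h)
  then have h: "h < horizon M" by simp
  let ?T = "\<lambda>h. PiM {0..<h} (\<lambda>_. step_space M)"
  have [measurable]: "(\<lambda>x. prefix_law M (K x) h) \<in> N \<rightarrow>\<^sub>M prob_algebra (?T h)"
    using Suc by simp
  have [measurable]: "state_law M h \<in> ?T h \<rightarrow>\<^sub>M prob_algebra (states M)"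
    using measurable_state_law h by simp
  note reward_kernel[OF h, measurable] K[OF h, measurable]
  \<comment> \<open>The argument is the nested tuple of parameter, prefix, state, action and reward,
    as the four binds build it up.\<close>
  have [measurable]: "(\<lambda>x. (snd (fst (fst (fst x)))) (h := (snd (fst (fst x)), snd (fst x), snd x)))
      \<in> (((N \<Otimes>\<^sub>M ?T h) \<Otimes>\<^sub>M states M) \<Otimes>\<^sub>M actions M) \<Otimes>\<^sub>M borel \<rightarrow>\<^sub>M ?T (Suc h)"
    by (rule measurable_fun_upd[where J="{0..<h}"]) (auto simp: step_space_def)
  show ?case
    unfolding prefix_law.simps by measurable
qed


lemma measurable_trajectory_law:
  assumes "\<And>h. h < horizon M \<Longrightarrow> (\<lambda>(x, s). K x h s) \<in> N \<Otimes>\<^sub>M states M \<rightarrow>\<^sub>M prob_algebra (actions M)"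
  shows "(\<lambda>x. trajectory_law M (K x)) \<in> N \<rightarrow>\<^sub>M prob_algebra (trajectory_space M)"
  unfolding trajectory_law_def trajectory_space_def by (rule measurable_prefix_law[OF assms order_refl])

lemma measurable_total_mean_reward: "total_mean_reward M \<in> borel_measurable (trajectory_space M)"
  unfolding total_mean_reward_def[abs_def]
proof (rule borel_measurable_sum)
  fix h assume "h \<in> {..<horizon M}"
  then have h: "h < horizon M" by simp
  have [measurable]: "reward M h \<in> states M \<Otimes>\<^sub>M actions M \<rightarrow>\<^sub>M subprob_algebra borel"
    by (rule measurable_prob_algebraD[OF reward_kernel[OF h]])
  have [measurable]: "(\<lambda>\<tau>. \<tau> h) \<in> trajectory_space M \<rightarrow>\<^sub>M states M \<Otimes>\<^sub>M actions M \<Otimes>\<^sub>M borel"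
    unfolding trajectory_space_def
    using measurable_component_singleton[of h "{0..<horizon M}" "\<lambda>_. step_space M"] h
    by (simp add: step_space_def)
  show "(\<lambda>\<tau>. mean_reward M h (fst (\<tau> h)) (fst (snd (\<tau> h)))) \<in> borel_measurable (trajectory_space M)"
    unfolding mean_reward_def by measurable
qed

lemma measurable_policy_value:
  assumes "\<And>h. h < horizon M \<Longrightarrow> (\<lambda>(x, s). K x h s) \<in> N \<Otimes>\<^sub>M states M \<rightarrow>\<^sub>M prob_algebra (actions M)"
  shows "(\<lambda>x. policy_value M (K x)) \<in> borel_measurable N"
proof -
  note measurable_total_mean_reward[measurable]
  have [measurable]: "(\<lambda>x. trajectory_law M (K x)) \<in> N \<rightarrow>\<^sub>M subprob_algebra (trajectory_space M)"
    by (rule measurable_prob_algebraD[OF measurable_trajectory_law[OF assms]])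
  show ?thesis unfolding policy_value_def by measurable
qed

lemma policy_value_le_optimal: "\<pi> \<in> policies M \<Longrightarrow> policy_value M \<pi> \<le> optimal_value M"
  unfolding optimal_value_def by (rule cSUP_upper[OF _ values_bounded])

end

section \<open>Run law and regret of a learning algorithm\<close>

locale learning_in_mdp = finite_horizon_mdp M + learning_algorithm M A
  for M :: "('s, 'a) mdp" and A :: "('s, 'a, 'u) algorithm"
begin

lemma select_in_policies:
  assumes "\<omega> \<in> space (PiM {0..<i} (\<lambda>_. round_space M A))" "u \<in> space (seed A)"
  shows "select A i \<omega> u \<in> policies M"
  unfolding policies_def
proof (safe)
  fix h assume "h < horizon M"
  from select_kernel[OF this, of i, unfolded split_beta']
  have [measurable]: "(\<lambda>x. select A i (fst x) (fst (snd x)) h (snd (snd x)))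
      \<in> PiM {0..<i} (\<lambda>_. round_space M A) \<Otimes>\<^sub>M seed A \<Otimes>\<^sub>M states M \<rightarrow>\<^sub>M prob_algebra (actions M)" .
  have "(\<lambda>s. (\<omega>, u, s)) \<in> states M \<rightarrow>\<^sub>M PiM {0..<i} (\<lambda>_. round_space M A) \<Otimes>\<^sub>M seed A \<Otimes>\<^sub>M states M"
    using assms by measurable
  from measurable_compose[OF this, of "\<lambda>x. select A i (fst x) (fst (snd x)) h (snd (snd x))" "prob_algebra (actions M)"]
  show "select A i \<omega> u h \<in> states M \<rightarrow>\<^sub>M prob_algebra (actions M)"
    by simp
qed

text \<open>Serves both the round law, where history and seed are the two projections of a pair, and
  the regret, where they are read off an infinite run.\<close>

lemma measurable_select:
  assumes f: "f \<in> N \<rightarrow>\<^sub>M PiM {0..<i} (\<lambda>_. round_space M A)" and g: "g \<in> N \<rightarrow>\<^sub>M seed A" and "h < horizon M"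
  shows "(\<lambda>(x, s). select A i (f x) (g x) h s) \<in> N \<Otimes>\<^sub>M states M \<rightarrow>\<^sub>M prob_algebra (actions M)"
proof -
  note f[measurable] g[measurable]
  have "(\<lambda>(x, s). (f x, g x, s)) \<in> N \<Otimes>\<^sub>M states M
      \<rightarrow>\<^sub>M PiM {0..<i} (\<lambda>_. round_space M A) \<Otimes>\<^sub>M seed A \<Otimes>\<^sub>M states M"
    by measurable
  from measurable_compose[OF this select_kernel[OF \<open>h < horizon M\<close>]]
  show ?thesis by (simp add: split_beta')
qed

lemma measurable_round_law:
  "round_law M A i \<in> PiM {0..<i} (\<lambda>_. round_space M A) \<rightarrow>\<^sub>M prob_algebra (round_space M A)"
proof -
  have [measurable]: "(\<lambda>_. seed A) \<in> PiM {0..<i} (\<lambda>_. round_space M A) \<rightarrow>\<^sub>M prob_algebra (seed A)"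
    by (rule measurable_const) (simp add: space_prob_algebra seed_prob)
  have [measurable]: "(\<lambda>x. trajectory_law M (select A i (fst x) (snd x)))
      \<in> PiM {0..<i} (\<lambda>_. round_space M A) \<Otimes>\<^sub>M seed A \<rightarrow>\<^sub>M prob_algebra (trajectory_space M)"
    by (rule measurable_trajectory_law measurable_select measurable_fst measurable_snd)+
  show ?thesis
    unfolding round_law_def[abs_def]
  proof (rule measurable_bind_prob_space2[where N="seed A"])
    show "(\<lambda>(\<omega>, u). trajectory_law M (select A i \<omega> u) \<bind> (\<lambda>\<tau>. return (round_space M A) (u, \<tau>)))
        \<in> PiM {0..<i} (\<lambda>_. round_space M A) \<Otimes>\<^sub>M seed A \<rightarrow>\<^sub>M prob_algebra (round_space M A)"
      unfolding split_beta'
    proof (rule measurable_bind_prob_space2[where N="trajectory_space M"])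
      show "(\<lambda>(x, \<tau>). return (round_space M A) (snd x, \<tau>))
          \<in> (PiM {0..<i} (\<lambda>_. round_space M A) \<Otimes>\<^sub>M seed A) \<Otimes>\<^sub>M trajectory_space M
            \<rightarrow>\<^sub>M prob_algebra (round_space M A)"
        unfolding round_space_def[of M A] by measurable
    qed measurable
  qed measurable
qed

text \<open>\<open>run_law\<close> is built from locale constants used outside their locale; this
  interpretation makes the facts about the Ionescu-Tulcea limit available for it.\<close>

sublocale IT: Ionescu_Tulcea "round_law M A" "\<lambda>_. round_space M A"
proof (rule Ionescu_Tulcea.intro)
  show "round_law M A i \<in> PiM {0..<i} (\<lambda>_. round_space M A) \<rightarrow>\<^sub>M subprob_algebra (round_space M A)" for i
    by (rule measurable_prob_algebraD[OF measurable_round_law])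
  show "prob_space (round_law M A i \<omega>)" if "\<omega> \<in> space (PiM {0..<i} (\<lambda>_. round_space M A))" for i \<omega>
    using measurable_space[OF measurable_round_law that] by (simp add: space_prob_algebra)
qed

lemma prob_space_run_law: "prob_space (run_law M A)"
  unfolding run_law_def by (rule IT.prob_space_lim)

lemma sets_run_law [measurable_cong]: "sets (run_law M A) = sets (PiM UNIV (\<lambda>_. round_space M A))"
  unfolding run_law_def by simp

lemma space_run_law: "space (run_law M A) = space (PiM UNIV (\<lambda>_. round_space M A))"
  by (rule sets_eq_imp_space_eq[OF sets_run_law])

text \<open>Puts the regret events into the sigma-algebra; outside it \<open>measure\<close>
  defaults to 0 and monotonicity could fail.\<close>

lemma measurable_regret [measurable]: "regret M A T \<in> borel_measurable (run_law M A)"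
proof -
  have "(\<lambda>\<omega>. restrict \<omega> {0..<i}) \<in> run_law M A \<rightarrow>\<^sub>M PiM {0..<i} (\<lambda>_. round_space M A)" for i
    unfolding measurable_cong_sets[OF sets_run_law refl] by (rule measurable_restrict_subset) simp
  moreover have "(\<lambda>\<omega>. fst (\<omega> i)) \<in> run_law M A \<rightarrow>\<^sub>M seed A" for i
  proof -
    have [measurable]: "(\<lambda>\<omega>. \<omega> i) \<in> PiM UNIV (\<lambda>_. round_space M A) \<rightarrow>\<^sub>M seed A \<Otimes>\<^sub>M trajectory_space M"
      using measurable_component_singleton[of i UNIV "\<lambda>_. round_space M A"] by (simp add: round_space_def)
    show ?thesis unfolding measurable_cong_sets[OF sets_run_law refl] by measurable
  qed
  ultimately have [measurable]: "(\<lambda>\<omega>. policy_value M (played_policy A i \<omega>)) \<in> borel_measurable (run_law M A)" for i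
    unfolding played_policy_def by (intro measurable_policy_value measurable_select)
  show ?thesis unfolding regret_def[abs_def] by measurable
qed

text \<open>Holds on every run, since each policy played lies in \<open>policies M\<close>, over
  which \<open>optimal_value\<close> is the supremum.\<close>

lemma regret_nonneg:
  assumes "\<omega> \<in> space (run_law M A)"
  shows "0 \<le> regret M A T \<omega>"
  unfolding regret_def
proof (rule sum_nonneg)
  fix i
  have "restrict \<omega> {0..<i} \<in> space (PiM {0..<i} (\<lambda>_. round_space M A))" "fst (\<omega> i) \<in> space (seed A)"
    using assms by (auto simp: space_run_law space_PiM PiE_iff round_space_def space_pair_measure mem_Times_iff)
  then have "played_policy A i \<omega> \<in> policies M"
    unfolding played_policy_def by (rule select_in_policies)
  then show "0 \<le> optimal_value M - policy_value M (played_policy A i \<omega>)"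
    using policy_value_le_optimal by simp
qed

end

section \<open>Delaying an algorithm by a whole number of rounds\<close>

definition delayed_algorithm ::
    "nat \<Rightarrow> ('s, 'a) policy \<Rightarrow> ('s, 'a, 'u) algorithm \<Rightarrow> ('s, 'a, 'u) algorithm" where
  "delayed_algorithm n \<pi>0 A =
    \<lparr>seed = seed A,
     select = (\<lambda>i \<omega> u. if i < n then \<pi>0 else select A (i - n) (\<lambda>j\<in>{0..<i - n}. \<omega> (n + j)) u)\<rparr>"

lemma seed_delayed_algorithm [simp]: "seed (delayed_algorithm n \<pi>0 A) = seed A"
  by (simp add: delayed_algorithm_def)

lemma round_space_delayed_algorithm [simp]: "round_space M (delayed_algorithm n \<pi>0 A) = round_space M A"
  by (simp add: round_space_def)

lemma select_delayed_algorithm: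
  "select (delayed_algorithm n \<pi>0 A) i \<omega> u =
    (if i < n then \<pi>0 else select A (i - n) (\<lambda>j\<in>{0..<i - n}. \<omega> (n + j)) u)"
  by (simp add: delayed_algorithm_def)

text \<open>An identity on every sequence of rounds. Truncated subtraction covers
  \<open>T \<le> n\<close>: the base algorithm then has no rounds and its regret is an empty
  sum.\<close>

lemma regret_delayed_algorithm:
  "regret M (delayed_algorithm n \<pi>0 A) T \<omega> =
    real (min T n) * (optimal_value M - policy_value M \<pi>0) + regret M A (T - n) (\<lambda>j. \<omega> (n + j))"
proof (induction T)
  case 0
  show ?case by (simp add: regret_def)
next
  case (Suc T)
  let ?A' = "delayed_algorithm n \<pi>0 A"
  have "regret M ?A' (Suc T) \<omega>
      = regret M ?A' T \<omega> + (optimal_value M - policy_value M (played_policy ?A' T \<omega>))"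
    by (simp add: regret_def)
  also have "\<dots> = real (min (Suc T) n) * (optimal_value M - policy_value M \<pi>0)
      + regret M A (Suc T - n) (\<lambda>j. \<omega> (n + j))"
  proof (cases "T < n")
    case True
    then show ?thesis
      unfolding Suc.IH by (simp add: played_policy_def select_delayed_algorithm min_def algebra_simps regret_def)
  next
    case False
    \<comment> \<open>For \<open>j < T - n\<close> the index \<open>n + j\<close> is below
      \<open>T\<close>, so cutting the history at \<open>T\<close> loses nothing that the base
      algorithm reads.\<close>
    have "(\<lambda>j\<in>{0..<T - n}. restrict \<omega> {0..<T} (n + j)) = restrict (\<lambda>j. \<omega> (n + j)) {0..<T - n}"
      by (auto simp: restrict_def fun_eq_iff)
    then have "played_policy ?A' T \<omega> = played_policy A (T - n) (\<lambda>j. \<omega> (n + j))"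
      using False by (simp add: played_policy_def select_delayed_algorithm)
    then show ?thesis
      unfolding Suc.IH using False by (simp add: regret_def Suc_diff_le)
  qed
  finally show ?case .
qed

context learning_in_mdp
begin

lemma learning_delayed_algorithm:
  assumes \<pi>0: "\<pi>0 \<in> policies M"
  shows "learning_in_mdp M (delayed_algorithm n \<pi>0 A)"
proof (intro learning_in_mdp.intro learning_algorithm.intro finite_horizon_mdp_axioms)
  show "prob_space (seed (delayed_algorithm n \<pi>0 A))"
    using seed_prob by simp
next
  fix i h assume h: "h < horizon M"
  show "(\<lambda>(\<omega>, u, s). select (delayed_algorithm n \<pi>0 A) i \<omega> u h s)
      \<in> PiM {0..<i} (\<lambda>_. round_space M (delayed_algorithm n \<pi>0 A))
          \<Otimes>\<^sub>M seed (delayed_algorithm n \<pi>0 A) \<Otimes>\<^sub>M states M \<rightarrow>\<^sub>M prob_algebra (actions M)"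
  proof (cases "i < n")
    case True
    have [measurable]: "\<pi>0 h \<in> states M \<rightarrow>\<^sub>M prob_algebra (actions M)"
      using \<pi>0 h by (simp add: policies_def)
    show ?thesis using True by (simp add: select_delayed_algorithm)
  next
    case False
    have [measurable]: "(\<lambda>\<omega>. \<lambda>j\<in>{0..<i - n}. \<omega> (n + j))
        \<in> PiM {0..<i} (\<lambda>_. round_space M A) \<rightarrow>\<^sub>M PiM {0..<i - n} (\<lambda>_. round_space M A)"
      by (rule measurable_restrict, rule measurable_component_singleton) auto
    have "(\<lambda>(\<omega>, u, s). (\<lambda>j\<in>{0..<i - n}. \<omega> (n + j), u, s))
        \<in> PiM {0..<i} (\<lambda>_. round_space M A) \<Otimes>\<^sub>M seed A \<Otimes>\<^sub>M states M
        \<rightarrow>\<^sub>M PiM {0..<i - n} (\<lambda>_. round_space M A) \<Otimes>\<^sub>M seed A \<Otimes>\<^sub>M states M"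
      by measurable
    from measurable_compose[OF this select_kernel[OF h]] show ?thesis
      using False by (simp add: select_delayed_algorithm split_beta')
  qed
qed

text \<open>After the baseline rounds the base algorithm behaves as if started from scratch: the
  hypothesis of the shift lemma holds because the delayed selection reads only the shifted
  history.\<close>

lemma distr_run_law_delayed_algorithm:
  assumes "\<pi>0 \<in> policies M"
  shows "distr (run_law M (delayed_algorithm n \<pi>0 A)) (PiM UNIV (\<lambda>_. round_space M A)) (\<lambda>\<omega> j. \<omega> (n + j))
    = run_law M A"
proof -
  interpret A': learning_in_mdp M "delayed_algorithm n \<pi>0 A"
    using assms by (rule learning_delayed_algorithm)
  have "round_law M (delayed_algorithm n \<pi>0 A) (n + i) \<omega> = round_law M A i (\<lambda>j\<in>{0..<i}. \<omega> (n + j))" for i \<omega>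
    by (simp add: round_law_def select_delayed_algorithm)
  then show ?thesis
    unfolding run_law_def
    using Ionescu_Tulcea_lim_shift[OF IT.Ionescu_Tulcea_axioms A'.IT.Ionescu_Tulcea_axioms] by simp
qed

text \<open>Transfers probability: the implication \<open>bound\<close> is checked run by run, and
  the good event is pulled back along the shift. The event covers all horizons at once because the
  base algorithm is evaluated after \<open>T - n\<close> rounds.\<close>

lemma measure_regret_delayed_algorithm_ge:
  assumes \<pi>0: "\<pi>0 \<in> policies M"
    and bound: "\<And>\<omega>. \<omega> \<in> space (run_law M A) \<Longrightarrow> \<forall>T\<ge>1. regret M A T \<omega> \<le> b T \<Longrightarrow>
      real (min T n) * (optimal_value M - policy_value M \<pi>0) + regret M A (T - n) \<omega> \<le> c"
  shows "measure (run_law M A) {\<omega> \<in> space (run_law M A). \<forall>T\<ge>1. regret M A T \<omega> \<le> b T}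
    \<le> measure (run_law M (delayed_algorithm n \<pi>0 A))
        {\<omega> \<in> space (run_law M (delayed_algorithm n \<pi>0 A)). regret M (delayed_algorithm n \<pi>0 A) T \<omega> \<le> c}"
proof -
  let ?A' = "delayed_algorithm n \<pi>0 A" and ?sh = "\<lambda>\<omega> j. \<omega> (n + j)"
  let ?E = "{\<omega> \<in> space (run_law M A). \<forall>T\<ge>1. regret M A T \<omega> \<le> b T}"
  interpret A': learning_in_mdp M ?A'
    using \<pi>0 by (rule learning_delayed_algorithm)
  interpret R: prob_space "run_law M ?A'" by (rule A'.prob_space_run_law)
  have sh: "?sh \<in> run_law M ?A' \<rightarrow>\<^sub>M PiM UNIV (\<lambda>_. round_space M A)"
    unfolding measurable_cong_sets[OF A'.sets_run_law refl] round_space_delayed_algorithm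
    by (rule measurable_PiM_single') (auto simp: space_PiM PiE_iff)
  have "?E \<in> sets (run_law M A)" by measurable
  then have E: "?E \<in> sets (PiM UNIV (\<lambda>_. round_space M A))" unfolding sets_run_law .
  have "measure (run_law M A) ?E
      = measure (distr (run_law M ?A') (PiM UNIV (\<lambda>_. round_space M A)) ?sh) ?E"
    by (simp only: distr_run_law_delayed_algorithm[OF \<pi>0])
  also have "\<dots> = measure (run_law M ?A') (?sh -` ?E \<inter> space (run_law M ?A'))"
    by (rule measure_distr[OF sh E])
  also have "\<dots> \<le> measure (run_law M ?A') {\<omega> \<in> space (run_law M ?A'). regret M ?A' T \<omega> \<le> c}"
  proof (rule R.finite_measure_mono)
    show "?sh -` ?E \<inter> space (run_law M ?A') \<subseteq> {\<omega> \<in> space (run_law M ?A'). regret M ?A' T \<omega> \<le> c}"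
      using bound by (auto simp: regret_delayed_algorithm)
  qed measurable
  finally show ?thesis .
qed

end

section \<open>The number of exploration rounds and the logarithmic factors\<close>

lemma budget_exploration_eq_delayed_algorithm:
  obtains n where "budget_exploration A \<pi>0 V0 \<alpha> \<Delta>0 C = delayed_algorithm n \<pi>0 A"
    and "real n \<le> max 0 (budget_threshold V0 \<alpha> \<Delta>0 C)"
proof
  define T0 where "T0 = budget_threshold V0 \<alpha> \<Delta>0 C"
  define n where "n = card {t::nat. 1 \<le> t \<and> real t < T0}"
  have set: "{t::nat. 1 \<le> t \<and> real t < T0} = {1..<nat \<lceil>T0\<rceil>}"
    by (auto simp: less_ceiling_iff zless_nat_eq_int_zless)
  \<comment> \<open>Round \<open>i\<close> is episode \<open>i + 1\<close>, so the real-valued test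
    of Budget-Exploration becomes a comparison with the count \<open>n\<close>.\<close>
  have less: "i < n \<longleftrightarrow> real (i + 1) < T0" for i
  proof -
    have "i < n \<longleftrightarrow> int i + 1 < \<lceil>T0\<rceil>" unfolding n_def set by auto
    then show ?thesis by (simp add: less_ceiling_iff add.commute)
  qed
  show "budget_exploration A \<pi>0 V0 \<alpha> \<Delta>0 C = delayed_algorithm n \<pi>0 A"
    unfolding budget_exploration_def delayed_algorithm_def Let_def T0_def[symmetric] n_def[symmetric] less ..
  show "real n \<le> max 0 (budget_threshold V0 \<alpha> \<Delta>0 C)"
    \<comment> \<open>If \<open>n\<close> is positive, its last exploration round is episode
      \<open>n\<close>, whence \<open>n < T0\<close>; otherwise the 0 in the maximum bounds
      it.\<close>
    using less[of "n - 1"] unfolding T0_def[symmetric] by (cases n) auto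
qed

text \<open>Raising the constant to \<open>max c 1\<close> and keeping the exponent gives all that
  is needed: monotonicity passes from \<open>T - n\<close> to \<open>T\<close> rounds, the lower
  bound 1 absorbs the exploration cost, and positivity of \<open>l\<close> fixes the sign of
  \<open>C\<close>.\<close>

lemma polylog_factor_monotone_ge_1:
  assumes "l \<in> polylog_factors"
  obtains l' where "l' \<in> polylog_factors" and "\<And>x y. 1 \<le> x \<Longrightarrow> x \<le> y \<Longrightarrow> l x \<le> l' y"
    and "\<And>x. 1 \<le> x \<Longrightarrow> 1 \<le> l' x" and "\<And>x. 1 \<le> x \<Longrightarrow> 0 < l x"
proof -
  from assms obtain c k where c: "0 < c" and l: "l = (\<lambda>x. c * (1 + ln x) ^ k)"
    by (auto simp: polylog_factors_def)
  show ?thesis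
  proof
    show "(\<lambda>x. max c 1 * (1 + ln x) ^ k) \<in> polylog_factors"
      by (auto simp: polylog_factors_def intro!: exI[of _ "max c 1"])
    show "l x \<le> max c 1 * (1 + ln y) ^ k" if "1 \<le> x" "x \<le> y" for x y
      unfolding l using c that by (intro mult_mono power_mono) auto
    show "1 \<le> max c 1 * (1 + ln x) ^ k" if "1 \<le> x" for x
      using mult_mono[of 1 "max c 1" 1 "(1 + ln x) ^ k"] that by (simp add: one_le_power)
    show "0 < l x" if "1 \<le> x" for x
      unfolding l using c that by (simp add: add_pos_nonneg)
  qed
qed

section \<open>Adding up the regret of the two phases on the good event\<close>

theorem theorem2:
  fixes l :: "real \<Rightarrow> real"
  assumes "l \<in> polylog_factors"
  shows "\<exists>l'\<in>polylog_factors.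
    \<forall>(M :: ('s, 'a) mdp) (A :: ('s, 'a, 'u) algorithm) \<pi>0 V0 \<Delta>0 \<alpha> \<delta> C Y.
      finite_horizon_mdp M \<and> learning_algorithm M A
      \<and> \<pi>0 \<in> policies M \<and> V0 = policy_value M \<pi>0 \<and> \<Delta>0 = optimal_value M - V0
      \<and> 0 < \<alpha> \<and> \<alpha> < 1 \<and> \<alpha> * V0 > 0 \<and> 0 < \<delta> \<and> \<delta> < 1 \<and> 1 \<le> Y
      \<and> measure (run_law M A)
           {\<omega> \<in> space (run_law M A).
             \<forall>T\<ge>1. regret M A T \<omega> \<le> l (Y * real T) * (C * sqrt (real T))} \<ge> 1 - \<delta>
      \<longrightarrow>
      (\<forall>T\<ge>1.
         let A' = budget_exploration A \<pi>0 V0 \<alpha> \<Delta>0 C in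
         measure (run_law M A')
           {\<omega> \<in> space (run_law M A').
             regret M A' T \<omega> \<le> l' (Y * real T)
               * (C * sqrt (real T) + C\<^sup>2 * \<Delta>0 / (\<alpha> * V0 * (\<alpha> * V0 + \<Delta>0)))} \<ge> 1 - \<delta>)"
proof -
  \<comment> \<open>\<open>l'\<close> is obtained from \<open>l\<close> alone, hence is uniform in
    the MDP, the algorithm and all parameters.\<close>
  obtain l' where l': "l' \<in> polylog_factors"
    and l_le: "\<And>x y. 1 \<le> x \<Longrightarrow> x \<le> y \<Longrightarrow> l x \<le> l' y"
    and l'_ge_1: "\<And>x. 1 \<le> x \<Longrightarrow> 1 \<le> l' x" and l_pos: "\<And>x. 1 \<le> x \<Longrightarrow> 0 < l x"
    using polylog_factor_monotone_ge_1[OF assms] by blast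
  show ?thesis
  proof (intro bexI[OF _ l'] allI impI, elim conjE)
    fix M :: "('s, 'a) mdp" and A :: "('s, 'a, 'u) algorithm" and \<pi>0 V0 \<Delta>0 \<alpha> \<delta> C Y and T :: nat
    assume M: "finite_horizon_mdp M" and A: "learning_algorithm M A"
      and \<pi>0: "\<pi>0 \<in> policies M" and V0: "V0 = policy_value M \<pi>0" and \<Delta>0: "\<Delta>0 = optimal_value M - V0"
      and \<alpha>V0: "\<alpha> * V0 > 0" and \<delta>: "\<delta> < 1" and Y: "1 \<le> Y" and T: "1 \<le> T"
      and prob: "measure (run_law M A)
           {\<omega> \<in> space (run_law M A).
             \<forall>T\<ge>1. regret M A T \<omega> \<le> l (Y * real T) * (C * sqrt (real T))} \<ge> 1 - \<delta>"
    interpret learning_in_mdp M A using M A by (simp add: learning_in_mdp_def)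
    obtain n where eq: "budget_exploration A \<pi>0 V0 \<alpha> \<Delta>0 C = delayed_algorithm n \<pi>0 A"
      and n: "real n \<le> max 0 (budget_threshold V0 \<alpha> \<Delta>0 C)"
      by (rule budget_exploration_eq_delayed_algorithm)
    have \<Delta>0_nonneg: "0 \<le> \<Delta>0"
      unfolding \<Delta>0 V0 using policy_value_le_optimal[OF \<pi>0] by simp
    let ?D = "C\<^sup>2 * \<Delta>0 / (\<alpha> * V0 * (\<alpha> * V0 + \<Delta>0))"
    have YT: "1 \<le> Y * real t" if "1 \<le> t" for t
      using mult_mono[of 1 Y 1 "real t"] that Y by simp
    \<comment> \<open>Total cost of exploration: at most threshold many rounds, each costing
      \<open>\<Delta>0\<close>. Nonnegativity of the threshold removes the maximum with 0.\<close>
    have nD: "real n * \<Delta>0 \<le> ?D"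
    proof -
      have threshold: "budget_threshold V0 \<alpha> \<Delta>0 C = C\<^sup>2 / (\<alpha> * V0 * (\<alpha> * V0 + \<Delta>0))"
        by (simp add: budget_threshold_def mult.commute)
      also have "\<dots> \<ge> 0" using \<alpha>V0 \<Delta>0_nonneg by simp
      finally have "real n \<le> C\<^sup>2 / (\<alpha> * V0 * (\<alpha> * V0 + \<Delta>0))" using n threshold by simp
      from mult_right_mono[OF this \<Delta>0_nonneg] show ?thesis by simp
    qed
    have "1 - \<delta> \<le> measure (run_law M (delayed_algorithm n \<pi>0 A))
      {\<omega> \<in> space (run_law M (delayed_algorithm n \<pi>0 A)). regret M (delayed_algorithm n \<pi>0 A) T \<omega>
        \<le> l' (Y * real T) * (C * sqrt (real T) + ?D)}"
    proof (rule order_trans[OF prob], rule measure_regret_delayed_algorithm_ge[OF \<pi>0])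
      fix \<omega> assume \<omega>: "\<omega> \<in> space (run_law M A)"
        and reg: "\<forall>T\<ge>1. regret M A T \<omega> \<le> l (Y * real T) * (C * sqrt (real T))"
      \<comment> \<open>A one-round horizon at a point of the good event forces \<open>C\<close> to
        be nonnegative, as the regret is nonnegative and \<open>l Y\<close> is positive.\<close>
      have "0 \<le> l (Y * real 1) * (C * sqrt (real 1))"
        using regret_nonneg[OF \<omega>, of 1] reg order.trans by blast
      then have C: "0 \<le> C"
        using l_pos[OF Y] by (simp add: zero_le_mult_iff)
      have "real (min T n) * \<Delta>0 \<le> real n * \<Delta>0"
        using \<Delta>0_nonneg by (intro mult_right_mono) auto
      also have "\<dots> \<le> l' (Y * real T) * ?D"
      proof -
        have "0 \<le> ?D" using \<Delta>0_nonneg \<alpha>V0 by simp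
        from mult_right_mono[OF l'_ge_1[OF YT[OF T]] this] show ?thesis using nD by simp
      qed
      finally have explore: "real (min T n) * \<Delta>0 \<le> l' (Y * real T) * ?D" .
      have "regret M A (T - n) \<omega> \<le> l' (Y * real T) * (C * sqrt (real T))"
      \<comment> \<open>The good event speaks only of horizons at least 1, so the case of no base
        rounds is separate; there the regret is 0.\<close>
      proof (cases "T \<le> n")
        case True
        then show ?thesis using l'_ge_1[OF YT[OF T]] C by (simp add: regret_def)
      next
        case False
        then have "1 \<le> T - n" by simp
        then have "regret M A (T - n) \<omega> \<le> l (Y * real (T - n)) * (C * sqrt (real (T - n)))"
          using reg by blast
        \<comment> \<open>Both the logarithmic factor and the square root grow when
          \<open>T - n\<close> is replaced by \<open>T\<close>.\<close>
        also have "\<dots> \<le> l' (Y * real T) * (C * sqrt (real T))"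
          using C Y l'_ge_1[OF YT[OF T]] by (intro mult_mono l_le mult_left_mono YT[OF \<open>1 \<le> T - n\<close>]) auto
        finally show ?thesis .
      qed
      with explore show "real (min T n) * (optimal_value M - policy_value M \<pi>0) + regret M A (T - n) \<omega>
          \<le> l' (Y * real T) * (C * sqrt (real T) + ?D)"
        by (simp add: \<Delta>0 V0 distrib_left)
    qed
    then show "let A' = budget_exploration A \<pi>0 V0 \<alpha> \<Delta>0 C in
         measure (run_law M A')
           {\<omega> \<in> space (run_law M A').
             regret M A' T \<omega> \<le> l' (Y * real T) * (C * sqrt (real T) + ?D)} \<ge> 1 - \<delta>"
      unfolding Let_def eq .
  qed
qed

end
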